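(* Let $P=(\varphi_n)_{n=0}^\infty$ be a fixed sequence of functions as in the context. Let $x_0\in(0,1]$, let $(x_n)_{n=1}^\infty$ be a sequence of numbers from $(0,1]\setminus\{x_0\}$, and for each $n\in\mathbb{N}$ let $k_n$ be the minimum number $j\in\mathbb{N}$ such that $p_j(x_n)\neq p_j(x_0)$. If $\lim_{n\to\infty}k_n=\infty$, then $\lim_{n\to\infty}x_n=x_0$.
   Context: $\mathbb{N}=\{1,2,3,\ldots\}$. Fix a sequence $P=(\varphi_n)_{n=0}^\infty$, where $\varphi_0\in\mathbb{N}$ is a constant and, for $n\ge 1$, $\varphi_n\colon\mathbb{N}^n\to\mathbb{N}$ is an arbitrary function. The $P$-representation (positive Perron expansion) of $x\in(0,1]$ is the expansion $$x=\sum_{n=0}^{\infty}\frac{r_0 r_1\cdots r_n}{(p_1-1)p_1\cdots(p_n-1)p_n\,p_{n+1}},$$ where $p_1,p_2,\ldots\in\mathbb{N}$, $r_0=\varphi_0$, $r_n=\varphi_n(p_1,\ldots,p_n)$ and $p_n\ge r_{n-1}+1$ for all $n\in\mathbb{N}$ (the $n=0$ term is $r_0/p_1$). It is known that for every such $P$ each $x\in(0,1]$ has a unique $P$-representation; the number $p_n=p_n(x)$ is called the $n$th $P$-digit of $x$. *)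

theory Defs
  imports Complex_Main
begin

text \<open>
  Throughout, the positive integers are rendered as those \<open>n :: nat\<close> with \<open>1 \<le> n\<close>. The sequence
  \<open>P = (\<phi>\<^sub>0, \<phi>\<^sub>1, \<dots>)\<close> is a single function \<open>\<phi>\<close> on lists: \<open>\<phi>\<^sub>n\<close> is the restriction of \<open>\<phi>\<close> to the
  lists of length \<open>n\<close>, and the constant \<open>\<phi>\<^sub>0\<close> is \<open>\<phi> []\<close>. The values of \<open>\<phi>\<close> on lists containing \<open>0\<close>
  are irrelevant.
\<close>

definition perron_system :: "(nat list \<Rightarrow> nat) \<Rightarrow> bool" where
  "perron_system \<phi> \<longleftrightarrow> (\<forall>ps. (\<forall>p\<in>set ps. 1 \<le> p) \<longrightarrow> 1 \<le> \<phi> ps)"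

text \<open>Digit sequences \<open>p :: nat \<Rightarrow> nat\<close> are indexed from \<open>1\<close>; the value \<open>p 0\<close> is never used.\<close>

definition perron_r :: "(nat list \<Rightarrow> nat) \<Rightarrow> (nat \<Rightarrow> nat) \<Rightarrow> nat \<Rightarrow> nat" where
  "perron_r \<phi> p n = \<phi> (map p [1..<n + 1])"

definition perron_term :: "(nat list \<Rightarrow> nat) \<Rightarrow> (nat \<Rightarrow> nat) \<Rightarrow> nat \<Rightarrow> real" where
  "perron_term \<phi> p n =
     (\<Prod>i=0..n. real (perron_r \<phi> p i)) /
     ((\<Prod>i=1..n. (real (p i) - 1) * real (p i)) * real (p (n + 1)))"

definition P_representation :: "(nat list \<Rightarrow> nat) \<Rightarrow> (nat \<Rightarrow> nat) \<Rightarrow> real \<Rightarrow> bool" where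
  "P_representation \<phi> p x \<longleftrightarrow>
     (\<forall>n\<ge>1. 1 \<le> p n \<and> perron_r \<phi> p (n - 1) + 1 \<le> p n) \<and> perron_term \<phi> p sums x"

text \<open>
  For a system \<open>\<phi>\<close>, \<open>0 < x \<le> 1\<close> and \<open>1 \<le> n\<close>, the \<open>n\<close>th digit of the \<open>P\<close>-representation of \<open>x\<close> exists
  and is unique. The description ranges over the digit rather than over the whole sequence because
  \<open>p 0\<close> is not determined by \<open>x\<close>.
\<close>

definition P_digit :: "(nat list \<Rightarrow> nat) \<Rightarrow> nat \<Rightarrow> real \<Rightarrow> nat" where
  "P_digit \<phi> n x = (THE d. \<exists>p. P_representation \<phi> p x \<and> p n = d)"

end

theory Submission
  imports Defs
begin

text \<open>
  The digits are produced by a self-similar subdivision of \<open>(0, 1]\<close>. For a positive integer \<open>r\<close> the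
  intervals \<open>(r / d, r / (d - 1)]\<close> with \<open>d > r\<close> partition \<open>(0, 1]\<close>, and
  \<open>y \<mapsto> r / d + r / ((d - 1) d) \<cdot> y\<close> maps \<open>(0, 1]\<close> onto the interval with index \<open>d\<close>. A
  \<open>P\<close>-representation iterates such maps, where the value of \<open>r\<close> at each step is a function of the
  digits chosen so far. Hence the numbers with prescribed first \<open>n\<close> digits form an interval
  \<open>(S, S + s]\<close>, where \<open>S\<close> is the \<open>n\<close>th partial sum and \<open>s\<close> is the product of the contraction ratios
  \<open>r / ((d - 1) d) \<le> 1 / d \<le> 1 / 2\<close>; in particular \<open>s \<le> 2\<^sup>-\<^sup>n\<close>
  (\<open>perron_remainder_pos\<close>, \<open>perron_remainder_le_scale\<close>, \<open>perron_scale_le\<close>).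

  Two consequences carry the theorem. First, the digits of a number are well defined: they exist
  because the subdivision can be followed down (\<open>P_representation_exists\<close>), and they are unique
  because the first difference would put the number into two disjoint intervals
  (\<open>P_representation_unique\<close>). Secondly, two numbers with the same first \<open>N\<close> digits lie in one
  interval of length at most \<open>2\<^sup>-\<^sup>N\<close> (\<open>P_digit_agree_imp_close\<close>). Now \<open>x\<^sub>n\<close> and \<open>x\<^sub>0\<close> agree in the first
  \<open>k\<^sub>n - 1\<close> digits and \<open>k\<^sub>n\<close> tends to infinity.
\<close>

section \<open>Remainders of admissible digit sequences\<close>

definition perron_admissible :: "(nat list \<Rightarrow> nat) \<Rightarrow> (nat \<Rightarrow> nat) \<Rightarrow> bool" where
  "perron_admissible \<phi> p \<longleftrightarrow> (\<forall>n. perron_r \<phi> p n < p (Suc n))"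

text \<open>The length of the interval of all numbers whose first \<open>n\<close> digits are those of \<open>p\<close>.\<close>

definition perron_scale :: "(nat list \<Rightarrow> nat) \<Rightarrow> (nat \<Rightarrow> nat) \<Rightarrow> nat \<Rightarrow> real" where
  "perron_scale \<phi> p n =
     (\<Prod>i<n. real (perron_r \<phi> p i)) / (\<Prod>i=1..n. (real (p i) - 1) * real (p i))"

lemma P_representation_iff:
  "P_representation \<phi> p x \<longleftrightarrow> perron_admissible \<phi> p \<and> perron_term \<phi> p sums x"
proof -
  have "(\<forall>n\<ge>1. 1 \<le> p n \<and> perron_r \<phi> p (n - 1) + 1 \<le> p n) \<longleftrightarrow> perron_admissible \<phi> p"
    unfolding perron_admissible_def
  proof safe
    fix n
    assume "\<forall>n\<ge>1. 1 \<le> p n \<and> perron_r \<phi> p (n - 1) + 1 \<le> p n"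
    from spec[OF this, of "Suc n"] show "perron_r \<phi> p n < p (Suc n)"
      by simp
  next
    fix n :: nat
    assume *: "\<forall>n. perron_r \<phi> p n < p (Suc n)" and "1 \<le> n"
    then obtain m where "n = Suc m"
      by (cases n) auto
    with * show "1 \<le> p n" "perron_r \<phi> p (n - 1) + 1 \<le> p n"
      by (metis One_nat_def Suc_leI less_nat_zero_code not_gr_zero,
          metis Suc_eq_plus1 Suc_leI diff_Suc_1)
  qed
  then show ?thesis
    unfolding P_representation_def by blast
qed

lemma perron_r_pos:
  assumes "perron_system \<phi>" and "perron_admissible \<phi> p"
  shows "0 < perron_r \<phi> p n"
proof -
  have "1 \<le> p i" if "1 \<le> i" for i
    using that assms(2) by (cases i) (auto simp: perron_admissible_def Suc_le_eq intro: le_less_trans[OF le0])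
  then have "\<forall>d\<in>set (map p [1..<n + 1]). 1 \<le> d"
    by auto
  with assms(1) have "1 \<le> perron_r \<phi> p n"
    unfolding perron_system_def perron_r_def by blast
  then show ?thesis
    by simp
qed

lemma perron_scale_0: "perron_scale \<phi> p 0 = 1"
  by (simp add: perron_scale_def)

lemma perron_scale_Suc:
  "perron_scale \<phi> p (Suc n) = perron_scale \<phi> p n *
     (real (perron_r \<phi> p n) / ((real (p (Suc n)) - 1) * real (p (Suc n))))"
  by (simp add: perron_scale_def)

lemma perron_term_eq_scale:
  "perron_term \<phi> p n = perron_scale \<phi> p n * (real (perron_r \<phi> p n) / real (p (Suc n)))"
proof -
  have "{0..n} = insert n {..<n}"
    by auto
  then show ?thesis
    by (simp add: perron_term_def perron_scale_def)
qed

lemma perron_scale_pos: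
  assumes "perron_system \<phi>" and "perron_admissible \<phi> p"
  shows "0 < perron_scale \<phi> p n"
proof (induction n)
  case 0
  then show ?case
    by (simp add: perron_scale_0)
next
  case (Suc n)
  have "0 < perron_r \<phi> p n" "perron_r \<phi> p n < p (Suc n)"
    using perron_r_pos[OF assms] assms(2) by (auto simp: perron_admissible_def)
  with Suc show ?case
    by (simp add: perron_scale_Suc)
qed

lemma perron_term_pos:
  assumes "perron_system \<phi>" and "perron_admissible \<phi> p"
  shows "0 < perron_term \<phi> p n"
proof -
  have "0 < perron_r \<phi> p n" "perron_r \<phi> p n < p (Suc n)"
    using perron_r_pos[OF assms] assms(2) by (auto simp: perron_admissible_def)
  with perron_scale_pos[OF assms, of n] show ?thesis
    by (simp add: perron_term_eq_scale)
qed

text \<open>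
  Each ratio satisfies \<open>r / ((d - 1) d) \<le> 1 / d\<close> since \<open>r \<le> d - 1\<close>, and \<open>d > r \<ge> 1\<close> gives \<open>d \<ge> 2\<close>.
\<close>

lemma perron_scale_le:
  assumes "perron_system \<phi>" and "perron_admissible \<phi> p"
  shows "perron_scale \<phi> p n \<le> (1 / 2) ^ n"
proof (induction n)
  case 0
  then show ?case
    by (simp add: perron_scale_0)
next
  case (Suc n)
  define r d where "r = real (perron_r \<phi> p n)" and "d = real (p (Suc n))"
  have "0 < perron_r \<phi> p n" "perron_r \<phi> p n + 1 \<le> p (Suc n)"
    using perron_r_pos[OF assms] assms(2) by (auto simp: perron_admissible_def Suc_le_eq)
  then have r: "1 \<le> r" "r + 1 \<le> d"
    unfolding r_def d_def by linarith+
  then have "r * 2 \<le> (d - 1) * d"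
    by (intro mult_mono) auto
  with r have "r / ((d - 1) * d) \<le> 1 / 2"
    by (simp add: divide_simps)
  with Suc perron_scale_pos[OF assms, of n] r
  have "perron_scale \<phi> p n * (r / ((d - 1) * d)) \<le> (1 / 2) ^ n * (1 / 2)"
    by (intro mult_mono) auto
  then show ?case
    by (simp add: perron_scale_Suc r_def d_def mult.commute)
qed

text \<open>
  The bound \<open>r / d + r / ((d - 1) d) = r / (d - 1) \<le> 1\<close>, scaled: the right endpoint of an interval of the
  next generation does not exceed that of its parent. Hence the partial sums plus the scales
  decrease, which bounds the tail of the series from above.
\<close>

lemma perron_term_add_scale_Suc_le:
  assumes "perron_system \<phi>" and "perron_admissible \<phi> p"
  shows "perron_term \<phi> p n + perron_scale \<phi> p (Suc n) =
           perron_scale \<phi> p n * (real (perron_r \<phi> p n) / (real (p (Suc n)) - 1))"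
    and "perron_term \<phi> p n + perron_scale \<phi> p (Suc n) \<le> perron_scale \<phi> p n"
proof -
  define r d where "r = real (perron_r \<phi> p n)" and "d = real (p (Suc n))"
  have "0 < perron_r \<phi> p n" "perron_r \<phi> p n + 1 \<le> p (Suc n)"
    using perron_r_pos[OF assms] assms(2) by (auto simp: perron_admissible_def Suc_le_eq)
  then have r: "1 \<le> r" "r + 1 \<le> d"
    unfolding r_def d_def by linarith+
  have "r / d + r / ((d - 1) * d) = r / (d - 1)"
    using r by (simp add: divide_simps) (simp add: algebra_simps)
  then show eq: "perron_term \<phi> p n + perron_scale \<phi> p (Suc n) =
      perron_scale \<phi> p n * (real (perron_r \<phi> p n) / (real (p (Suc n)) - 1))"
    unfolding perron_term_eq_scale perron_scale_Suc
    by (metis d_def distrib_left r_def)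
  have "r / (d - 1) \<le> 1"
    using r by simp
  with perron_scale_pos[OF assms, of n]
  show "perron_term \<phi> p n + perron_scale \<phi> p (Suc n) \<le> perron_scale \<phi> p n"
    unfolding eq r_def d_def by (metis less_imp_le mult.right_neutral mult_left_mono)
qed

lemma perron_remainder_pos:
  assumes "perron_system \<phi>" and "perron_admissible \<phi> p" and "perron_term \<phi> p sums x"
  shows "(\<Sum>m<n. perron_term \<phi> p m) < x"
  using sum_less_suminf[of "perron_term \<phi> p" n] perron_term_pos[OF assms(1,2)] assms(3)
  by (simp add: sums_iff)

lemma perron_remainder_le_scale:
  assumes "perron_system \<phi>" and "perron_admissible \<phi> p" and "perron_term \<phi> p sums x"
  shows "x \<le> (\<Sum>m<n. perron_term \<phi> p m) + perron_scale \<phi> p n"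
proof -
  have decr: "(\<Sum>m<N. perron_term \<phi> p m) + perron_scale \<phi> p N \<le>
      (\<Sum>m<n. perron_term \<phi> p m) + perron_scale \<phi> p n" if "n \<le> N" for N
    using that
  proof (induction N rule: dec_induct)
    case (step N)
    then show ?case
      using perron_term_add_scale_Suc_le(2)[OF assms(1,2), of N] by simp
  qed simp
  have "(\<Sum>m<N. perron_term \<phi> p m) \<le> (\<Sum>m<n. perron_term \<phi> p m) + perron_scale \<phi> p n"
    if "n \<le> N" for N
    using decr[OF that] perron_scale_pos[OF assms(1,2), of N] by linarith
  then show ?thesis
    using assms(3) by (intro LIMSEQ_le_const2[of "\<lambda>N. \<Sum>m<N. perron_term \<phi> p m"])
      (auto simp: sums_def)
qed

section \<open>Dependence on finitely many digits\<close>

lemma perron_r_cong: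
  assumes "\<And>j. 1 \<le> j \<Longrightarrow> j \<le> n \<Longrightarrow> p j = q j"
  shows "perron_r \<phi> p n = perron_r \<phi> q n"
proof -
  have "map p [1..<n + 1] = map q [1..<n + 1]"
    using assms by (intro map_cong) auto
  then show ?thesis
    unfolding perron_r_def by (rule arg_cong)
qed

lemma perron_scale_cong:
  assumes "\<And>j. 1 \<le> j \<Longrightarrow> j \<le> n \<Longrightarrow> p j = q j"
  shows "perron_scale \<phi> p n = perron_scale \<phi> q n"
  using assms
proof (induction n)
  case (Suc n)
  then show ?case
    using perron_r_cong[of n p q] by (simp add: perron_scale_Suc)
qed (simp add: perron_scale_0)

lemma perron_partial_sum_cong:
  assumes "\<And>j. 1 \<le> j \<Longrightarrow> j \<le> n \<Longrightarrow> p j = q j"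
  shows "(\<Sum>m<n. perron_term \<phi> p m) = (\<Sum>m<n. perron_term \<phi> q m)"
proof (rule sum.cong[OF refl])
  fix m
  assume "m \<in> {..<n}"
  with assms show "perron_term \<phi> p m = perron_term \<phi> q m"
    using perron_r_cong[of m p q \<phi>] perron_scale_cong[of m p q \<phi>]
    by (simp add: perron_term_eq_scale)
qed

section \<open>Existence and uniqueness of the digits\<close>

text \<open>
  The two remainder bounds after \<open>n + 1\<close> digits, divided by the scale after \<open>n\<close> digits. The rescaled
  remainder \<open>y\<close> depends only on \<open>x\<close> and the first \<open>n\<close> digits, so the bounds can be compared between
  two digit sequences that agree so far.
\<close>

lemma perron_remainder_locates_digit:
  fixes n :: nat
  assumes "perron_system \<phi>" and "P_representation \<phi> p x"
  defines "y \<equiv> (x - (\<Sum>m<n. perron_term \<phi> p m)) / perron_scale \<phi> p n"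
  shows "real (perron_r \<phi> p n) / real (p (Suc n)) < y"
    and "y \<le> real (perron_r \<phi> p n) / (real (p (Suc n)) - 1)"
proof -
  have adm: "perron_admissible \<phi> p" and sums: "perron_term \<phi> p sums x"
    using assms(2) by (auto simp: P_representation_iff)
  note pos = perron_scale_pos[OF assms(1) adm, of n]
  have "perron_term \<phi> p n < x - (\<Sum>m<n. perron_term \<phi> p m)"
    using perron_remainder_pos[OF assms(1) adm sums, of "Suc n"] by simp
  with pos show "real (perron_r \<phi> p n) / real (p (Suc n)) < y"
    unfolding y_def perron_term_eq_scale by (subst pos_less_divide_eq) (simp_all add: mult.commute)
  have "x - (\<Sum>m<n. perron_term \<phi> p m) \<le> perron_term \<phi> p n + perron_scale \<phi> p (Suc n)"
    using perron_remainder_le_scale[OF assms(1) adm sums, of "Suc n"] by simp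
  with pos show "y \<le> real (perron_r \<phi> p n) / (real (p (Suc n)) - 1)"
    unfolding y_def perron_term_add_scale_Suc_le(1)[OF assms(1) adm]
    by (subst pos_divide_le_eq) (simp_all add: mult.commute)
qed

text \<open>
  If \<open>d < e\<close>, then \<open>r / (e - 1) \<le> r / d\<close>, so the interval with index \<open>e\<close> ends where the one with
  index \<open>d\<close> begins or further to the left.
\<close>

lemma perron_intervals_disjoint:
  fixes r y :: real and d e :: nat
  assumes "0 < r" and "1 < d" and "1 < e"
    and "r / real d < y" and "y \<le> r / (real d - 1)"
    and "r / real e < y" and "y \<le> r / (real e - 1)"
  shows "d = e"
proof -
  have False if "a < b" "1 < a" "r / real a < y" "y \<le> r / (real b - 1)" for a b :: nat
  proof -
    have "real a \<le> real b - 1"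
      using that by linarith
    then have "r / (real b - 1) \<le> r / real a"
      using that assms(1) by (intro divide_left_mono mult_pos_pos) auto
    with that show False
      by linarith
  qed
  with assms show ?thesis
    by (meson linorder_neqE_nat)
qed

lemma P_representation_unique:
  assumes "perron_system \<phi>" and "P_representation \<phi> p x" and "P_representation \<phi> q x"
    and "1 \<le> n"
  shows "p n = q n"
  using \<open>1 \<le> n\<close>
proof (induction n rule: less_induct)
  case (less n)
  then obtain m where n: "n = Suc m"
    by (cases n) auto
  have agree: "p j = q j" if "1 \<le> j" "j \<le> m" for j
    using less.IH[of j] that n by simp
  have adm: "perron_admissible \<phi> p" "perron_admissible \<phi> q"
    using assms by (auto simp: P_representation_iff)
  have r: "perron_r \<phi> p m = perron_r \<phi> q m" "0 < perron_r \<phi> q m"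
    using perron_r_cong[of m p q] agree perron_r_pos[OF assms(1) adm(2)] by auto
  have large: "1 < p (Suc m)" "1 < q (Suc m)"
    using adm r unfolding perron_admissible_def by (metis Suc_lessI less_trans_Suc not_less_eq One_nat_def)+
  show ?case
    using perron_remainder_locates_digit[OF assms(1,2), of m]
      perron_remainder_locates_digit[OF assms(1,3), of m] r large
      perron_intervals_disjoint[of "real (perron_r \<phi> q m)" "p n" "q n"]
      perron_scale_cong[of m p q \<phi>] perron_partial_sum_cong[of m p q \<phi>] agree n
    by simp
qed

text \<open>
  The expansion algorithm. The state after \<open>n\<close> steps consists of the first \<open>n\<close> digits and the
  position of \<open>x\<close> inside their interval, rescaled to \<open>(0, 1]\<close>. The condition
  \<open>r / d < y \<le> r / (d - 1)\<close> says \<open>d - 1 \<le> r / y < d\<close>, whence the digit \<open>\<lfloor>r / y\<rfloor> + 1\<close>.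
\<close>

definition next_digit :: "nat \<Rightarrow> real \<Rightarrow> nat" where
  "next_digit r y = nat \<lfloor>real r / y\<rfloor> + 1"

primrec perron_state :: "(nat list \<Rightarrow> nat) \<Rightarrow> real \<Rightarrow> nat \<Rightarrow> nat list \<times> real" where
  "perron_state \<phi> x 0 = ([], x)"
| "perron_state \<phi> x (Suc n) =
     (let (ps, y) = perron_state \<phi> x n; r = \<phi> ps; d = next_digit r y
      in (ps @ [d], (y - real r / real d) * ((real d - 1) * real d) / real r))"

lemma next_digit_bounds:
  fixes r :: nat and y :: real
  assumes "1 \<le> r" and "0 < y" and "y \<le> 1"
  defines "d \<equiv> next_digit r y"
  shows "r < d" and "0 < (y - real r / real d) * ((real d - 1) * real d) / real r"
    and "(y - real r / real d) * ((real d - 1) * real d) / real r \<le> 1"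
proof -
  have "real r \<le> real r / y"
    using assms by (simp add: pos_le_divide_eq mult_left_le)
  then have "int r \<le> \<lfloor>real r / y\<rfloor>"
    by (simp add: le_floor_iff)
  then show "r < d"
    unfolding d_def next_digit_def by linarith
  have floor: "real d - 1 = of_int \<lfloor>real r / y\<rfloor>"
    using \<open>int r \<le> \<lfloor>real r / y\<rfloor>\<close> unfolding d_def next_digit_def by simp
  have d: "1 < real d" "0 < real r"
    using \<open>r < d\<close> \<open>1 \<le> r\<close> by linarith+
  have "real r / y < real d"
    using floor by linarith
  then have "real r < real d * y"
    using \<open>0 < y\<close> by (simp add: pos_divide_less_eq)
  with d have "real r / real d < y"
    by (simp add: pos_divide_less_eq mult.commute)
  with d show "0 < (y - real r / real d) * ((real d - 1) * real d) / real r"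
    by simp
  have "real d - 1 \<le> real r / y"
    unfolding floor by simp
  then have "(real d - 1) * y \<le> real r"
    using \<open>0 < y\<close> by (simp add: pos_le_divide_eq)
  then have "((real d - 1) * y) * real d \<le> real r * real d"
    using d by (intro mult_right_mono) auto
  moreover have "(y - real r / real d) * ((real d - 1) * real d) =
      ((real d - 1) * y) * real d - real r * real d + real r"
    using d by (simp add: field_simps)
  ultimately show "(y - real r / real d) * ((real d - 1) * real d) / real r \<le> 1"
    using d by simp
qed

lemma P_representation_exists:
  assumes "perron_system \<phi>" and "0 < x" and "x \<le> 1"
  obtains p where "P_representation \<phi> p x"
proof -
  define ps y where "ps = (\<lambda>n. fst (perron_state \<phi> x n))" and "y = (\<lambda>n. snd (perron_state \<phi> x n))"
  define p where "p = (\<lambda>n. next_digit (\<phi> (ps (n - 1))) (y (n - 1)))"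
  have ps_Suc: "ps (Suc n) = ps n @ [p (Suc n)]" for n
    by (simp add: ps_def p_def y_def Let_def split: prod.split)
  have y_Suc: "y (Suc n) = (y n - real (\<phi> (ps n)) / real (p (Suc n))) *
      ((real (p (Suc n)) - 1) * real (p (Suc n))) / real (\<phi> (ps n))" for n
    by (simp add: ps_def p_def y_def Let_def split: prod.split)
  have "ps n = map p [1..<n + 1]" for n
    by (induction n) (simp add: ps_def, simp add: ps_Suc)
  then have r: "perron_r \<phi> p n = \<phi> (ps n)" for n
    by (simp add: perron_r_def)
  have inv: "0 < y n \<and> y n \<le> 1 \<and> (\<forall>d\<in>set (ps n). 1 \<le> d)" for n
  proof (induction n)
    case 0
    then show ?case
      using assms by (simp add: y_def ps_def)
  next
    case (Suc n)
    then have "1 \<le> \<phi> (ps n)"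
      using assms(1) by (simp add: perron_system_def)
    then show ?case
      using next_digit_bounds[of "\<phi> (ps n)" "y n"] Suc
      by (simp add: y_Suc ps_Suc p_def)
  qed
  then have \<phi>_pos: "1 \<le> \<phi> (ps n)" for n
    using assms(1) by (simp add: perron_system_def)
  have less: "\<phi> (ps n) < p (Suc n)" for n
    using next_digit_bounds(1)[OF \<phi>_pos] inv[of n] by (simp add: p_def)
  then have adm: "perron_admissible \<phi> p"
    by (simp add: perron_admissible_def r)
  have rem: "(\<Sum>m<n. perron_term \<phi> p m) = x - perron_scale \<phi> p n * y n" for n
  proof (induction n)
    case 0
    then show ?case
      by (simp add: perron_scale_0 y_def)
  next
    case (Suc n)
    define r' d where "r' = real (\<phi> (ps n))" and "d = real (p (Suc n))"
    have "0 < r'" "1 < d"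
      using \<phi>_pos[of n] less[of n] unfolding r'_def d_def by linarith+
    then have "y n = r' / d + r' / ((d - 1) * d) * y (Suc n)"
      unfolding y_Suc r'_def[symmetric] d_def[symmetric] by simp
    then have "perron_scale \<phi> p n * y n = perron_term \<phi> p n + perron_scale \<phi> p (Suc n) * y (Suc n)"
      unfolding perron_term_eq_scale perron_scale_Suc r r'_def[symmetric] d_def[symmetric]
      by (metis distrib_left mult.assoc)
    with Suc show ?case
      by simp
  qed
  have "(\<lambda>n. perron_scale \<phi> p n * y n) \<longlonglongrightarrow> 0"
  proof (rule tendsto_sandwich)
    show "\<forall>\<^sub>F n in sequentially. 0 \<le> perron_scale \<phi> p n * y n"
      using perron_scale_pos[OF assms(1) adm] inv by (simp add: less_imp_le)
    have "perron_scale \<phi> p n * y n \<le> (1 / 2) ^ n * 1" for n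
      using perron_scale_le[OF assms(1) adm, of n] inv[of n] by (intro mult_mono) auto
    then show "\<forall>\<^sub>F n in sequentially. perron_scale \<phi> p n * y n \<le> (1 / 2) ^ n"
      by simp
    show "(\<lambda>n. (1 / 2 :: real) ^ n) \<longlonglongrightarrow> 0"
      by (rule LIMSEQ_realpow_zero) auto
  qed simp
  then have "(\<lambda>n. x - perron_scale \<phi> p n * y n) \<longlonglongrightarrow> x"
    by (auto intro: tendsto_eq_intros)
  then have "perron_term \<phi> p sums x"
    by (simp add: sums_def rem)
  with adm show thesis
    using that by (simp add: P_representation_iff)
qed

lemma P_digit_eq:
  assumes "perron_system \<phi>" and "P_representation \<phi> p x" and "1 \<le> n"
  shows "P_digit \<phi> n x = p n"
  unfolding P_digit_def
  using assms P_representation_unique[OF assms(1)] by (intro the_equality) blast+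

section \<open>Convergence from agreement of digits\<close>

lemma P_digit_agree_imp_close:
  assumes "perron_system \<phi>" and "x \<in> {0<..1}" and "z \<in> {0<..1}"
    and "\<And>j. 1 \<le> j \<Longrightarrow> j \<le> N \<Longrightarrow> P_digit \<phi> j x = P_digit \<phi> j z"
  shows "\<bar>x - z\<bar> \<le> (1 / 2) ^ N"
proof -
  obtain p where p: "P_representation \<phi> p x"
    using P_representation_exists[OF assms(1)] assms(2) by auto
  obtain q where q: "P_representation \<phi> q z"
    using P_representation_exists[OF assms(1)] assms(3) by auto
  have agree: "p j = q j" if "1 \<le> j" "j \<le> N" for j
    using assms(4)[OF that] P_digit_eq[OF assms(1) p that(1)] P_digit_eq[OF assms(1) q that(1)]
    by simp
  have p': "perron_admissible \<phi> p" "perron_term \<phi> p sums x"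
    and q': "perron_admissible \<phi> q" "perron_term \<phi> q sums z"
    using p q by (auto simp: P_representation_iff)
  show ?thesis
    using perron_remainder_pos[OF assms(1) p', of N] perron_remainder_pos[OF assms(1) q', of N]
      perron_remainder_le_scale[OF assms(1) p', of N] perron_remainder_le_scale[OF assms(1) q', of N]
      perron_scale_cong[of N p q \<phi>] perron_partial_sum_cong[of N p q \<phi>] agree
      perron_scale_le[OF assms(1) p'(1), of N]
    by simp
qed

theorem proposition1:
  fixes \<phi> :: "nat list \<Rightarrow> nat" and x\<^sub>0 :: real and x :: "nat \<Rightarrow> real" and k :: "nat \<Rightarrow> nat"
  assumes "perron_system \<phi>"
    and "x\<^sub>0 \<in> {0<..1}"
    and "\<And>n. 1 \<le> n \<Longrightarrow> x n \<in> {0<..1} - {x\<^sub>0}"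
    and "\<And>n. 1 \<le> n \<Longrightarrow> k n = (LEAST j. 1 \<le> j \<and> P_digit \<phi> j (x n) \<noteq> P_digit \<phi> j x\<^sub>0)"
    and "filterlim k at_top sequentially"
  shows "x \<longlonglongrightarrow> x\<^sub>0"
proof (rule tendstoI)
  fix e :: real
  assume "0 < e"
  obtain N where N: "(1 / 2 :: real) ^ N < e"
    using real_arch_pow_inv[OF \<open>0 < e\<close>, of "1 / 2"] by auto
  have "\<forall>\<^sub>F n in sequentially. Suc N \<le> k n"
    using assms(5) unfolding filterlim_at_top by blast
  then show "\<forall>\<^sub>F n in sequentially. dist (x n) x\<^sub>0 < e"
    using eventually_ge_at_top[of 1]
  proof eventually_elim
    case (elim n)
    have "P_digit \<phi> j (x n) = P_digit \<phi> j x\<^sub>0" if "1 \<le> j" "j \<le> N" for j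
      using not_less_Least[of j "\<lambda>j. 1 \<le> j \<and> P_digit \<phi> j (x n) \<noteq> P_digit \<phi> j x\<^sub>0"]
        assms(4)[of n] elim that by auto
    then have "\<bar>x n - x\<^sub>0\<bar> \<le> (1 / 2) ^ N"
      using P_digit_agree_imp_close[OF assms(1) _ assms(2), of "x n" N] assms(3)[of n] elim by blast
    with N show ?case
      by (simp add: dist_real_def)
  qed
qed

end
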